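(* Assume $\diamondsuit^+$. Let $G$ be an undirected graph with $|V(G)|=\chi(G)=\omega_1$. Then there is an orientation $D^*$ of $G$ such that whenever $A\subseteq V(G)$ satisfies $\chi(G[A])=\omega_1$ and $D$ is any orientation of the half graph $H_{\omega,\omega}$, $D$ embeds (as a not necessarily induced subdigraph) into $D^*[A]$.
   Context: $\diamondsuit^+$ is the statement that there are countable families $\mathcal S_\beta\subseteq\mathcal P(\beta)$, $\beta<\omega_1$, such that for every $X\subseteq\omega_1$ there is a club $C\subseteq\omega_1$ with $X\cap\beta\in\mathcal S_\beta$ and $C\cap\beta\in\mathcal S_\beta$ for all $\beta\in C$. The half graph $H_{\omega,\omega}$ has vertex set $\omega\times 2$, and $(k,i)(\ell,j)$ is an edge iff $k\leq\ell<\omega$, $i=0$, $j=1$. An orientation of an undirected graph $G$ is a digraph on the same vertex set containing, for each edge $uv$ of $G$, exactly one of the arcs $uv$, $vu$, and no other arcs. $\chi$ is the chromatic number. *)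

theory Defs
  imports Main "HOL-Library.Countable_Set"
begin

text \<open>W is a well-order of the whole type 'w of order type omega_1:
  uncountable, with every proper initial segment countable.
  The ordinal beta < omega_1 corresponds to the set underS W beta of its predecessors.\<close>

definition is_omega1 :: "'w rel \<Rightarrow> bool" where
  "is_omega1 W \<longleftrightarrow> well_order_on UNIV W \<and> \<not> countable (UNIV :: 'w set)
     \<and> (\<forall>\<beta>. countable (underS W \<beta>))"

definition lt :: "'w rel \<Rightarrow> 'w \<Rightarrow> 'w \<Rightarrow> bool" where
  "lt W \<alpha> \<beta> \<longleftrightarrow> (\<alpha>, \<beta>) \<in> W \<and> \<alpha> \<noteq> \<beta>"

definition club :: "'w rel \<Rightarrow> 'w set \<Rightarrow> bool" where
  "club W C \<longleftrightarrow>
     (\<forall>\<alpha>. \<exists>\<gamma>\<in>C. lt W \<alpha> \<gamma>) \<and>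
     (\<forall>\<beta>. (\<exists>\<alpha>. lt W \<alpha> \<beta>) \<and> (\<forall>\<alpha>. lt W \<alpha> \<beta> \<longrightarrow> (\<exists>\<gamma>\<in>C. lt W \<alpha> \<gamma> \<and> lt W \<gamma> \<beta>))
        \<longrightarrow> \<beta> \<in> C)"

definition diamond_plus :: "'w rel \<Rightarrow> bool" where
  "diamond_plus W \<longleftrightarrow>
     (\<exists>S :: 'w \<Rightarrow> 'w set set.
        (\<forall>\<beta>. countable (S \<beta>) \<and> S \<beta> \<subseteq> Pow (underS W \<beta>)) \<and>
        (\<forall>X :: 'w set. \<exists>C. club W C \<and>
            (\<forall>\<beta>\<in>C. X \<inter> underS W \<beta> \<in> S \<beta> \<and> C \<inter> underS W \<beta> \<in> S \<beta>)))"

definition graph :: "'a set \<Rightarrow> ('a \<Rightarrow> 'a \<Rightarrow> bool) \<Rightarrow> bool" where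
  "graph V E \<longleftrightarrow> (\<forall>u v. E u v \<longrightarrow> u \<in> V \<and> v \<in> V \<and> E v u \<and> u \<noteq> v)"

definition proper_colouring :: "('a \<Rightarrow> 'a \<Rightarrow> bool) \<Rightarrow> 'a set \<Rightarrow> ('a \<Rightarrow> 'c) \<Rightarrow> 'c set \<Rightarrow> bool" where
  "proper_colouring E A c K \<longleftrightarrow> c ` A \<subseteq> K \<and> (\<forall>u\<in>A. \<forall>v\<in>A. E u v \<longrightarrow> c u \<noteq> c v)"

text \<open>chi(G[A]) = |Omega|: G[A] is colourable with |Omega| colours and with no
  smaller cardinal number of colours (colour sets taken inside Omega's type, which
  contains sets of all cardinalities up to |Omega|).\<close>

definition chromatic_eq :: "('a \<Rightarrow> 'a \<Rightarrow> bool) \<Rightarrow> 'a set \<Rightarrow> 'c set \<Rightarrow> bool" where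
  "chromatic_eq E A \<Omega> \<longleftrightarrow>
     (\<exists>c. proper_colouring E A c \<Omega>) \<and>
     (\<forall>K. K \<subseteq> \<Omega> \<and> (card_of K, card_of \<Omega>) \<in> ordLess \<longrightarrow> \<not> (\<exists>c. proper_colouring E A c K))"

definition orientation :: "('a \<Rightarrow> 'a \<Rightarrow> bool) \<Rightarrow> 'a rel \<Rightarrow> bool" where
  "orientation E D \<longleftrightarrow>
     (\<forall>u v. (u, v) \<in> D \<longrightarrow> E u v) \<and>
     (\<forall>u v. E u v \<longrightarrow> ((u, v) \<in> D \<longleftrightarrow> (v, u) \<notin> D))"

definition half_V :: "(nat \<times> nat) set" where
  "half_V = UNIV \<times> {0, 1}"

definition half_E :: "nat \<times> nat \<Rightarrow> nat \<times> nat \<Rightarrow> bool" where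
  "half_E x y \<longleftrightarrow>
     (\<lambda>(k, i) (l, j). k \<le> l \<and> i = 0 \<and> j = 1) x y \<or>
     (\<lambda>(k, i) (l, j). k \<le> l \<and> i = 0 \<and> j = 1) y x"

definition embeds_into :: "'b set \<Rightarrow> 'b rel \<Rightarrow> 'a rel \<Rightarrow> 'a set \<Rightarrow> bool" where
  "embeds_into VD D D' A \<longleftrightarrow>
     (\<exists>f. inj_on f VD \<and> f ` VD \<subseteq> A \<and> (\<forall>(x, y)\<in>D. (f x, f y) \<in> D'))"

end

theory Submission
  imports Defs "HOL-Algebra.Free_Abelian_Groups"
begin

text \<open>Identify the vertex set with \<open>\<omega>\<^sub>1\<close> and let \<open>N y\<close> be the set of neighbours below \<open>y\<close>. The
  orientation is given by sets \<open>T y\<close>, the edge \<open>xy\<close> with \<open>x < y\<close> pointing upwards iff \<open>x \<in> T y\<close>.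
  Each guess in \<open>S \<delta>\<close> with \<open>\<delta> \<le> y\<close> is read as a set of requirements \<open>T y \<inter> F = P\<close> with \<open>F\<close> finite; for
  each of these countably many guesses that has requirements with \<open>F \<subseteq> N y\<close> avoiding any given
  finite set, \<open>T y\<close> is chosen to meet one of them.

  For uncountably chromatic \<open>A\<close>, call a requirement bad if only countably many \<open>y \<in> A\<close> meet it with
  \<open>F \<subseteq> N y\<close>. The bad set is guessed on a club; pass to \<open>\<delta>\<close> closed enough that bad requirements below
  \<open>\<delta>\<close> are met only by elements below \<open>\<delta>\<close>. As \<open>A\<close> is not countably colourable, some such \<open>\<delta>\<close> and some
  \<open>y \<in> A\<close> with \<open>y \<ge> \<delta>\<close> have \<open>N y \<inter> A \<inter> \<delta>\<close> infinite. Now \<open>y\<close> meets no bad requirement below \<open>\<delta>\<close>, so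
  by the choice of \<open>T y\<close> some finite set meets all bad \<open>F \<subseteq> N y \<inter> \<delta>\<close>. Off that finite set, every
  pattern on every finite subset of \<open>N y \<inter> A \<inter> \<delta>\<close> is realised by uncountably many elements of \<open>A\<close>,
  which yields all orientations of the half graph.\<close>

section \<open>Recursive choices and greedy colouring\<close>

lemma injective_choice_from_infinite_sets:
  fixes U :: "nat \<Rightarrow> 'a set"
  assumes inf: "\<And>n. infinite (U n)"
  obtains y where "inj y" and "\<And>n. y n \<in> U n"
proof -
  define pick where "pick n Z = (SOME a. a \<in> U n - Z)" for n and Z :: "'a set"
  define Z where "Z = rec_nat {} (\<lambda>n Z. insert (pick n Z) Z)"
  have Z_Suc: "Z (Suc n) = insert (pick n (Z n)) (Z n)" for n
    by (simp add: Z_def)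
  have fin: "finite (Z n)" for n
    by (induction n) (simp add: Z_def, simp add: Z_Suc)
  have pick: "pick n (Z n) \<in> U n - Z n" for n
  proof -
    have "infinite (U n - Z n)"
      using inf fin by (simp add: Diff_infinite_finite)
    then have "\<exists>a. a \<in> U n - Z n"
      by (metis ex_in_conv finite.emptyI)
    then show ?thesis
      unfolding pick_def by (rule someI_ex)
  qed
  have mono: "Z m \<subseteq> Z n" if "m \<le> n" for m n
    using that by (rule lift_Suc_mono_le[of Z, rotated]) (auto simp: Z_Suc)
  have "pick m (Z m) \<noteq> pick n (Z n)" if "m < n" for m n
    using mono[of "Suc m" n] that pick[of n] by (auto simp: Z_Suc)
  then have "inj (\<lambda>n. pick n (Z n))"
    by (metis (mono_tags, lifting) injI linorder_neqE_nat)
  then show ?thesis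
    using that pick by blast
qed

text \<open>An index \<open>\<xi>\<close> codes the requirement \<open>T \<inter> F = P \<inter> F\<close>, where \<open>c \<xi> = (F, P)\<close>. Requirements with
  disjoint first components are independent of each other.\<close>

lemma ex_set_meeting_requirements:
  fixes c :: "'i \<Rightarrow> 'a set \<times> 'a set"
  assumes "countable \<B>" and fin_c: "\<And>\<xi>. finite (fst (c \<xi>))"
  shows "\<exists>T. \<forall>B\<in>\<B>. (\<forall>Z. finite Z \<longrightarrow> (\<exists>\<xi>\<in>B. fst (c \<xi>) \<subseteq> N - Z)) \<longrightarrow>
    (\<exists>\<xi>\<in>B. fst (c \<xi>) \<subseteq> N \<and> T \<inter> fst (c \<xi>) = snd (c \<xi>) \<inter> fst (c \<xi>))"
proof (cases "{B \<in> \<B>. \<forall>Z. finite Z \<longrightarrow> (\<exists>\<xi>\<in>B. fst (c \<xi>) \<subseteq> N - Z)} = {}")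
  case True
  then show ?thesis
    by blast
next
  case False
  define \<H> where "\<H> = {B \<in> \<B>. \<forall>Z. finite Z \<longrightarrow> (\<exists>\<xi>\<in>B. fst (c \<xi>) \<subseteq> N - Z)}"
  have ne: "\<H> \<noteq> {}" and cnt: "countable \<H>"
    using False \<open>countable \<B>\<close> by (auto simp: \<H>_def)
  \<comment> \<open>\<open>Z n\<close> collects the first components of the requirements chosen so
    far. Taking the next one off \<open>Z n\<close> keeps them pairwise disjoint, so their patterns
    can be glued into one set \<open>T\<close>.\<close>
  define pick where
    "pick n Z = (SOME \<xi>. \<xi> \<in> from_nat_into \<H> n \<and> fst (c \<xi>) \<subseteq> N - Z)" for n Z
  define Z where "Z = rec_nat {} (\<lambda>n Z. Z \<union> fst (c (pick n Z)))"
  define \<xi> where "\<xi> n = pick n (Z n)" for n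
  have Z_Suc: "Z (Suc n) = Z n \<union> fst (c (\<xi> n))" for n
    by (simp add: Z_def \<xi>_def)
  have fin: "finite (Z n)" for n
    by (induction n) (simp add: Z_def, simp add: Z_Suc fin_c)
  have \<xi>: "\<xi> n \<in> from_nat_into \<H> n \<and> fst (c (\<xi> n)) \<subseteq> N - Z n" for n
  proof -
    have "\<exists>\<xi>. \<xi> \<in> from_nat_into \<H> n \<and> fst (c \<xi>) \<subseteq> N - Z n"
      using from_nat_into[OF ne, of n] fin[of n] unfolding \<H>_def by blast
    then show ?thesis
      unfolding pick_def \<xi>_def by (rule someI_ex)
  qed
  have mono: "Z m \<subseteq> Z n" if "m \<le> n" for m n
    using that by (rule lift_Suc_mono_le[of Z, rotated]) (auto simp: Z_Suc)
  have less_disj: "fst (c (\<xi> m)) \<inter> fst (c (\<xi> n)) = {}" if "m < n" for m n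
    using mono[of "Suc m" n] that \<xi>[of n] by (auto simp: Z_Suc)
  have disj: "fst (c (\<xi> m)) \<inter> fst (c (\<xi> n)) = {}" if "m \<noteq> n" for m n
    using less_disj[of m n] less_disj[of n m] that by (metis Int_commute linorder_neqE_nat)
  define T where "T = (\<Union>n. snd (c (\<xi> n)) \<inter> fst (c (\<xi> n)))"
  have T: "T \<inter> fst (c (\<xi> n)) = snd (c (\<xi> n)) \<inter> fst (c (\<xi> n))" for n
  proof -
    have "m = n" if "a \<in> fst (c (\<xi> m))" "a \<in> fst (c (\<xi> n))" for a m
      using disj[of m n] that by blast
    then show ?thesis
      unfolding T_def by auto
  qed
  show ?thesis
  proof (intro exI[of _ T] ballI impI)
    fix B assume "B \<in> \<B>" and "\<forall>Z. finite Z \<longrightarrow> (\<exists>\<xi>\<in>B. fst (c \<xi>) \<subseteq> N - Z)"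
    then have "B \<in> \<H>"
      by (auto simp: \<H>_def)
    then obtain n where "from_nat_into \<H> n = B"
      using from_nat_into_surj[OF cnt] by blast
    then show "\<exists>\<xi>\<in>B. fst (c \<xi>) \<subseteq> N \<and> T \<inter> fst (c \<xi>) = snd (c \<xi>) \<inter> fst (c \<xi>)"
      using \<xi>[of n] T[of n] by (intro bexI[of _ "\<xi> n"]) auto
  qed
qed

text \<open>Greedy colouring along \<open>R\<close>: the finitely many predecessors of
  \<open>y\<close> leave some natural number free.\<close>

lemma wf_finite_predecessors_colouring:
  assumes "wf R" and fin: "\<And>y. finite {x. (x, y) \<in> R}"
  obtains col :: "'a \<Rightarrow> nat" where "\<And>x y. (x, y) \<in> R \<Longrightarrow> col x \<noteq> col y"
proof -
  define F :: "('a \<Rightarrow> nat) \<Rightarrow> 'a \<Rightarrow> nat" where "F col y = (SOME n. n \<notin> col ` {x. (x, y) \<in> R})" for col y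
  have F: "F col y \<notin> col ` {x. (x, y) \<in> R}" for col y
    unfolding F_def using fin[of y] by (intro someI_ex[of "\<lambda>n. n \<notin> _"] ex_new_if_finite) auto
  define col where "col = wfrec R F"
  have "col x \<noteq> col y" if "(x, y) \<in> R" for x y
  proof -
    have "col y = F (cut col R y) y"
      unfolding col_def by (rule wfrec[OF \<open>wf R\<close>])
    then have "col y \<notin> cut col R y ` {x. (x, y) \<in> R}"
      using F by metis
    then show ?thesis
      using cut_apply[OF that, of col] that by force
  qed
  then show ?thesis
    using that by blast
qed

section \<open>The order and clubs of omega_1, and colourings along a club\<close>

locale omega1 =
  fixes W :: "'w rel"
  assumes is_omega1: "is_omega1 W"
begin

abbreviation less (infix "<\<^sub>W" 50) where "x <\<^sub>W y \<equiv> lt W x y"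

lemma underS_eq: "underS W b = {a. a <\<^sub>W b}"
  by (auto simp: underS_def lt_def)

lemma well_order: "well_order_on UNIV W"
  using is_omega1 by (simp add: is_omega1_def)

lemma irrefl [simp]: "\<not> a <\<^sub>W a"
  by (simp add: lt_def)

lemma linear: "a <\<^sub>W b \<or> a = b \<or> b <\<^sub>W a"
  using well_order
  by (auto simp: lt_def well_order_on_def linear_order_on_def total_on_def)

lemma trans: "a <\<^sub>W b \<Longrightarrow> b <\<^sub>W c \<Longrightarrow> a <\<^sub>W c"
  using well_order
  by (auto simp: lt_def well_order_on_def linear_order_on_def partial_order_on_def
      preorder_on_def antisym_def dest: transD)

lemma wf_less: "wf {(a, b). a <\<^sub>W b}"
proof -
  have "{(a, b). a <\<^sub>W b} = W - Id"
    by (auto simp: lt_def)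
  then show ?thesis
    using well_order by (simp add: well_order_on_def)
qed

lemma ex_least:
  assumes "P a"
  obtains m where "P m" and "\<And>b. b <\<^sub>W m \<Longrightarrow> \<not> P b"
  using wf_less[unfolded wf_eq_minimal, rule_format, of a "Collect P"] assms by auto

lemma countable_less: "countable {a. a <\<^sub>W b}"
  using is_omega1 by (simp add: is_omega1_def underS_eq)

lemma uncountable_UNIV: "\<not> countable (UNIV :: 'w set)"
  using is_omega1 by (simp add: is_omega1_def)

text \<open>A countable union of countable initial segments cannot exhaust the uncountable order; a
  point outside it is the bound.\<close>

lemma countable_bounded:
  assumes "countable K"
  obtains b where "\<And>k. k \<in> K \<Longrightarrow> k <\<^sub>W b"
proof -
  have "countable (\<Union>k\<in>K. insert k {a. a <\<^sub>W k})"
    using assms countable_less by auto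
  then obtain b where "b \<notin> (\<Union>k\<in>K. insert k {a. a <\<^sub>W k})"
    using uncountable_UNIV by (metis UNIV_eq_I)
  then show ?thesis
    using that linear by blast
qed

lemma finite_bounded_below:
  assumes "finite F" "F \<noteq> {}" "\<And>x. x \<in> F \<Longrightarrow> x <\<^sub>W d"
  obtains a where "a <\<^sub>W d" and "F \<subseteq> insert a {x. x <\<^sub>W a}"
proof -
  have "\<exists>a. a <\<^sub>W d \<and> F \<subseteq> insert a {x. x <\<^sub>W a}"
    using assms
  proof (induction F rule: finite_ne_induct)
    case (singleton x)
    then show ?case by blast
  next
    case (insert x F)
    then obtain a where a: "a <\<^sub>W d" "F \<subseteq> insert a {x. x <\<^sub>W a}"
      by auto
    show ?case
    proof (cases "x <\<^sub>W a")
      case True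
      then show ?thesis using a by auto
    next
      case False
      then have "insert x F \<subseteq> insert x {z. z <\<^sub>W x}"
        using a linear trans by blast
      then show ?thesis using insert.prems by blast
    qed
  qed
  then show ?thesis
    using that by blast
qed

lemma club_unbounded: "club W C \<Longrightarrow> \<exists>c\<in>C. a <\<^sub>W c"
  by (auto simp: club_def)

lemma club_closed:
  assumes "club W C" "z <\<^sub>W b" "\<And>a. a <\<^sub>W b \<Longrightarrow> \<exists>c\<in>C. a <\<^sub>W c \<and> c <\<^sub>W b"
  shows "b \<in> C"
  using assms unfolding club_def by blast

text \<open>For unboundedness, iterate a function \<open>f\<close> whose value at \<open>b\<close>
  lies in \<open>C\<close> above \<open>b\<close> and bounds \<open>K x\<close> for every
  \<open>x\<close> below \<open>b\<close>; the supremum \<open>d\<close> of the iterates is closed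
  under \<open>K\<close>. For closedness, every point below a limit \<open>b\<close> of closure
  points lies below a closure point that is itself below \<open>b\<close>.\<close>

lemma club_closure_points:
  assumes C: "club W C" and cnt: "\<And>a. countable (K a)"
  shows "club W {d \<in> C. \<forall>a. a <\<^sub>W d \<longrightarrow> (\<forall>k\<in>K a. k <\<^sub>W d)}" (is "club W ?D")
  unfolding club_def
proof (intro conjI allI impI)
  fix a
  have step: "\<exists>c\<in>C. b <\<^sub>W c \<and> (\<forall>x. x <\<^sub>W b \<longrightarrow> (\<forall>k\<in>K x. k <\<^sub>W c))" for b
  proof -
    have "countable (insert b (\<Union>x\<in>{x. x <\<^sub>W b}. K x))"
      using cnt countable_less by auto
    then obtain e where "\<And>k. k \<in> insert b (\<Union>x\<in>{x. x <\<^sub>W b}. K x) \<Longrightarrow> k <\<^sub>W e"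
      using countable_bounded by blast
    moreover obtain c where "c \<in> C" "e <\<^sub>W c"
      using club_unbounded[OF C] by blast
    ultimately show ?thesis
      using trans by (intro bexI[of _ c]) blast+
  qed
  then obtain f where f: "\<And>b. f b \<in> C" "\<And>b. b <\<^sub>W f b"
    "\<And>b x k. x <\<^sub>W b \<Longrightarrow> k \<in> K x \<Longrightarrow> k <\<^sub>W f b"
    by metis
  define s where "s n = (f ^^ n) a" for n
  have s_Suc: "s (Suc n) = f (s n)" for n
    by (simp add: s_def)
  obtain b where "\<And>k. k \<in> range s \<Longrightarrow> k <\<^sub>W b"
    using countable_bounded[of "range s"] by auto
  then obtain d where d: "\<And>n. s n <\<^sub>W d" and min: "\<And>b. b <\<^sub>W d \<Longrightarrow> \<exists>n. \<not> s n <\<^sub>W b"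
    using ex_least[of "\<lambda>b. \<forall>n. s n <\<^sub>W b" b] by (metis rangeI)
  have below: "\<exists>n. x <\<^sub>W s n" if "x <\<^sub>W d" for x
    using min[OF that] f(2) s_Suc linear by metis
  have "d \<in> C"
  proof (rule club_closed[OF C d[of 0]])
    fix x assume "x <\<^sub>W d"
    then obtain n where "x <\<^sub>W s n"
      using below by blast
    then show "\<exists>c\<in>C. x <\<^sub>W c \<and> c <\<^sub>W d"
      using f(1,2) d[of "Suc n"] trans unfolding s_Suc by blast
  qed
  moreover have "k <\<^sub>W d" if "x <\<^sub>W d" "k \<in> K x" for x k
    using below[OF that(1)] f(3) that(2) d s_Suc trans by metis
  moreover have "a <\<^sub>W d"
    using d[of 0] by (simp add: s_def)
  ultimately show "\<exists>c\<in>?D. a <\<^sub>W c"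
    by blast
next
  fix b
  assume lim: "(\<exists>a. a <\<^sub>W b) \<and> (\<forall>a. a <\<^sub>W b \<longrightarrow> (\<exists>c\<in>?D. a <\<^sub>W c \<and> c <\<^sub>W b))"
  then obtain z where "z <\<^sub>W b"
    by blast
  then have "b \<in> C"
    by (rule club_closed[OF C]) (use lim in blast)
  moreover have "k <\<^sub>W b" if "a <\<^sub>W b" "k \<in> K a" for a k
  proof -
    from conjunct2[OF lim, rule_format, OF that(1)]
    obtain c where "c \<in> ?D" "a <\<^sub>W c" "c <\<^sub>W b"
      by (elim bexE conjE)
    then show ?thesis
      using that(2) trans[of k c b] by blast
  qed
  ultimately show "b \<in> ?D"
    by blast
qed

text \<open>Here \<open>\<not> y <\<^sub>W c\<close> says that \<open>c\<close> is at most
  \<open>y\<close>. The supremum \<open>d\<close> of all such \<open>c\<close> in \<open>C\<close>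
  is again in \<open>C\<close>: otherwise it would be a limit of elements of
  \<open>C\<close>.\<close>

lemma club_last_below:
  assumes C: "club W C" and "c \<in> C" "\<not> y <\<^sub>W c"
  obtains d where "d \<in> C" "\<not> y <\<^sub>W d" "\<And>c. c \<in> C \<Longrightarrow> \<not> y <\<^sub>W c \<Longrightarrow> \<not> d <\<^sub>W c"
proof -
  obtain d where d: "\<And>c. c \<in> C \<Longrightarrow> \<not> y <\<^sub>W c \<Longrightarrow> \<not> d <\<^sub>W c"
    and min: "\<And>b. b <\<^sub>W d \<Longrightarrow> \<exists>c\<in>C. \<not> y <\<^sub>W c \<and> b <\<^sub>W c"
    using ex_least[of "\<lambda>d. \<forall>c\<in>C. \<not> y <\<^sub>W c \<longrightarrow> \<not> d <\<^sub>W c" y] by metis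
  have "\<not> y <\<^sub>W d"
    using min[of y] by blast
  moreover have "d \<in> C"
  proof (rule ccontr)
    assume "d \<notin> C"
    then have lt: "c <\<^sub>W d" if "c \<in> C" "\<not> y <\<^sub>W c" for c
      using d that linear by blast
    have "d \<in> C"
      using min lt assms by (intro club_closed[OF C, of c]) blast+
    then show False
      using \<open>d \<notin> C\<close> by blast
  qed
  ultimately show ?thesis
    using that d by blast
qed

text \<open>A club cuts \<open>\<omega>\<^sub>1\<close> into countable blocks. Ordering each block in type \<open>\<omega>\<close>, every vertex
  of \<open>A\<close> has only finitely many earlier neighbours, so greedy colouring uses countably many colours.\<close>

lemma countable_colouring_if_finite_below_club:
  assumes C: "club W C" and "graph UNIV E"
    and fin: "\<And>d y. d \<in> C \<Longrightarrow> y \<in> A \<Longrightarrow> \<not> y <\<^sub>W d \<Longrightarrow> finite {x \<in> A. x <\<^sub>W d \<and> E x y}"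
  shows "\<exists>col :: 'w \<Rightarrow> nat. proper_colouring E A col UNIV"
proof -
  \<comment> \<open>\<open>nxt a\<close> is the least element of \<open>C\<close> above
    \<open>a\<close>, and the blocks are the fibres of \<open>nxt\<close>. Below, \<open>pos\<close>
    numbers the points of a block, and \<open>R\<close> compares blocks first and positions
    second.\<close>
  have "\<exists>c. c \<in> C \<and> a <\<^sub>W c \<and> (\<forall>b. b <\<^sub>W c \<longrightarrow> \<not> (b \<in> C \<and> a <\<^sub>W b))" for a
    using club_unbounded[OF C, of a] ex_least[of "\<lambda>c. c \<in> C \<and> a <\<^sub>W c"] by metis
  then obtain nxt where nxt: "\<And>a. nxt a \<in> C" "\<And>a. a <\<^sub>W nxt a"
    "\<And>a b. b \<in> C \<Longrightarrow> a <\<^sub>W b \<Longrightarrow> \<not> b <\<^sub>W nxt a"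
    by metis
  define pos where "pos a = to_nat_on {x. x <\<^sub>W nxt a} a" for a
  define R where "R = {(x, y). x \<in> A \<and> y \<in> A \<and> E x y \<and>
      (nxt x <\<^sub>W nxt y \<or> nxt x = nxt y \<and> pos x < pos y)}"
  have pos_inj: "x = y" if "nxt x = nxt y" "pos x = pos y" for x y
    using that nxt(2) inj_on_to_nat_on[OF countable_less[of "nxt y"]]
    unfolding pos_def inj_on_def by (metis mem_Collect_eq)
  have "wf (inv_image ({(a, b). a <\<^sub>W b} <*lex*> less_than) (\<lambda>x. (nxt x, pos x)))"
    using wf_less by (intro wf_inv_image wf_lex_prod) auto
  then have "wf R"
    by (rule wf_subset) (auto simp: R_def)
  moreover have "finite {x. (x, y) \<in> R}" for y
  proof -
    have "finite {x. nxt x = nxt y \<and> pos x < pos y}"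
    proof (rule finite_imageD)
      show "finite (pos ` {x. nxt x = nxt y \<and> pos x < pos y})"
        by (rule finite_subset[of _ "{..<pos y}"]) auto
      show "inj_on pos {x. nxt x = nxt y \<and> pos x < pos y}"
        using pos_inj by (auto intro!: inj_onI)
    qed
    \<comment> \<open>A neighbour in an earlier block lies below the last element \<open>d\<close>
      of \<open>C\<close> that is at most \<open>y\<close>, so \<open>fin\<close> applies. If there
      is no such \<open>d\<close>, then \<open>y\<close> is in the first block.\<close>
    moreover have "finite {x \<in> A. E x y \<and> nxt x <\<^sub>W nxt y}" if "y \<in> A"
    proof (cases "\<exists>c\<in>C. \<not> y <\<^sub>W c")
      case True
      then obtain d where d: "d \<in> C" "\<not> y <\<^sub>W d" "\<And>c. c \<in> C \<Longrightarrow> \<not> y <\<^sub>W c \<Longrightarrow> \<not> d <\<^sub>W c"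
        using club_last_below[OF C] by blast
      have "x <\<^sub>W d" if "nxt x <\<^sub>W nxt y" for x
      proof -
        have "\<not> y <\<^sub>W nxt x"
          using nxt that by blast
        then show ?thesis
          using d(3)[OF nxt(1)[of x]] nxt(2)[of x] linear trans by blast
      qed
      then show ?thesis
        using fin[OF d(1) that d(2)] by (auto elim: rev_finite_subset)
    next
      case False
      then have "\<not> nxt x <\<^sub>W nxt y" for x
        using nxt by blast
      then show ?thesis by simp
    qed
    ultimately show ?thesis
      by (rule_tac finite_subset[of _ "{x. nxt x = nxt y \<and> pos x < pos y} \<union>
            (if y \<in> A then {x \<in> A. E x y \<and> nxt x <\<^sub>W nxt y} else {})"])
        (auto simp: R_def)
  qed
  ultimately obtain col :: "'w \<Rightarrow> nat" where col: "\<And>x y. (x, y) \<in> R \<Longrightarrow> col x \<noteq> col y"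
    using wf_finite_predecessors_colouring by blast
  have "col x \<noteq> col y" if "x \<in> A" "y \<in> A" "E x y" for x y
  proof -
    have "E y x" "x \<noteq> y"
      using \<open>graph UNIV E\<close> \<open>E x y\<close> by (auto simp: graph_def)
    then have "(x, y) \<in> R \<or> (y, x) \<in> R"
      using that linear[of "nxt x" "nxt y"] pos_inj[of x y] linorder_less_linear[of "pos x" "pos y"]
      by (auto simp: R_def)
    then show ?thesis
      using col by metis
  qed
  then show ?thesis
    unfolding proper_colouring_def by blast
qed

section \<open>Coded patterns, the orientation and the half graph\<close>

text \<open>There are only omega_1 pairs of finite subsets of omega_1. Coding them by ordinals turns
  a set of requirements into a subset of omega_1, which diamond-plus can guess.\<close>

lemma ex_pattern_code:
  obtains c :: "'w \<Rightarrow> 'w set \<times> 'w set"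
  where "\<And>F P. finite F \<Longrightarrow> finite P \<Longrightarrow> (F, P) \<in> range c" and "\<And>\<xi>. finite (fst (c \<xi>))"
proof -
  have inf: "infinite (UNIV :: 'w set)"
    using uncountable_UNIV countable_finite by blast
  then have Fpow: "Fpow (UNIV :: 'w set) \<approx> (UNIV :: 'w set)"
    by (rule eqpoll_Fpow)
  have "Fpow (UNIV :: 'w set) \<times> Fpow (UNIV :: 'w set) \<approx> (UNIV :: 'w set) \<times> (UNIV :: 'w set)"
    using Fpow by (intro times_eqpoll_cong)
  also have "\<dots> \<approx> (UNIV :: 'w set)"
    using card_of_Times_same_infinite[OF inf] by (simp add: eqpoll_iff_card_of_ordIso)
  finally have "(UNIV :: 'w set) \<approx> Fpow (UNIV :: 'w set) \<times> Fpow (UNIV :: 'w set)"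
    by (rule eqpoll_sym)
  then obtain c :: "'w \<Rightarrow> 'w set \<times> 'w set" where "bij_betw c UNIV (Fpow UNIV \<times> Fpow UNIV)"
    unfolding eqpoll_def ..
  then have "range c = Fpow UNIV \<times> Fpow UNIV"
    by (simp add: bij_betw_def)
  then have "\<And>F P. finite F \<Longrightarrow> finite P \<Longrightarrow> (F, P) \<in> range c" "\<And>\<xi>. c \<xi> \<in> Fpow UNIV \<times> Fpow UNIV"
    by (auto simp: Fpow_def)
  then show ?thesis
    by (intro that[of c]) (auto simp: Fpow_def mem_Times_iff)
qed

text \<open>The larger endpoint alone decides the direction of an edge, so the sets
  \<open>T y\<close> can be chosen independently of each other.\<close>

definition upward_orientation :: "('w \<Rightarrow> 'w \<Rightarrow> bool) \<Rightarrow> ('w \<Rightarrow> 'w set) \<Rightarrow> 'w rel" where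
  "upward_orientation E T = {(u, v). E u v \<and> (if u <\<^sub>W v then u \<in> T v else v \<notin> T u)}"

lemma orientation_upward:
  assumes "graph UNIV E"
  shows "orientation E (upward_orientation E T)"
proof -
  have "E v u" "u \<noteq> v" if "E u v" for u v
    using assms that by (auto simp: graph_def)
  moreover have "\<not> (u <\<^sub>W v \<and> v <\<^sub>W u)" for u v
    using trans irrefl by blast
  ultimately show ?thesis
    using linear unfolding orientation_def upward_orientation_def by (auto split: if_splits; blast)
qed

text \<open>Vertices \<open>(k, 0)\<close> go to points \<open>x k\<close> of \<open>X\<close>, and
  \<open>(l, 1)\<close> goes to some \<open>y l\<close> in \<open>A\<close> joined to
  \<open>x 0, ..., x l\<close> with the directions prescribed by \<open>D\<close>. Uncountably many
  candidates for each \<open>y l\<close> leave room to keep all images distinct.\<close>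

lemma half_graph_embeds:
  assumes "graph UNIV E" and "infinite X" "X \<subseteq> A" and D: "orientation half_E D"
    and realised: "\<And>F P. finite F \<Longrightarrow> F \<noteq> {} \<Longrightarrow> F \<subseteq> X \<Longrightarrow> P \<subseteq> F \<Longrightarrow>
      \<not> countable {y \<in> A. F \<subseteq> {x. x <\<^sub>W y \<and> E x y} \<and> T y \<inter> F = P}"
  shows "embeds_into half_V D (upward_orientation E T) A"
proof -
  obtain x :: "nat \<Rightarrow> 'w" where x: "inj x" "range x \<subseteq> X"
    using \<open>infinite X\<close> by (meson infinite_countable_subset)
  define F where "F l = x ` {..l}" for l
  define P where "P l = x ` {k. k \<le> l \<and> ((k, 0), (l, 1)) \<in> D}" for l
  define U where "U l = {y \<in> A. F l \<subseteq> {x. x <\<^sub>W y \<and> E x y} \<and> T y \<inter> F l = P l}" for l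
  have "\<not> countable (U l)" for l
    unfolding U_def using x by (intro realised) (auto simp: F_def P_def)
  then have "infinite (U l - range x)" for l
    using uncountable_minus_countable[of "U l" "range x"] countable_finite by auto
  then obtain y where y: "inj y" "\<And>l. y l \<in> U l - range x"
    by (metis injective_choice_from_infinite_sets[of "\<lambda>l. U l - range x"])
  define f where "f = (\<lambda>(k, i :: nat). if i = 0 then x k else y k)"
  have ne: "x k \<noteq> y l" for k l
    using y(2)[of l] by (metis DiffD2 rangeI)
  have "inj_on f half_V"
    using x(1) y(1) ne ne[symmetric] by (auto simp: inj_on_def f_def half_V_def)
  moreover have "f ` half_V \<subseteq> A"
    using x(2) y(2) \<open>X \<subseteq> A\<close> by (force simp: f_def half_V_def U_def)
  moreover have "(f u, f v) \<in> upward_orientation E T" if uv: "(u, v) \<in> D" for u v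
  proof -
    have edge: "x k <\<^sub>W y l \<and> E (x k) (y l) \<and> E (y l) (x k) \<and> (x k \<in> T (y l) \<longleftrightarrow> ((k, 0), (l, 1)) \<in> D)"
      if "k \<le> l" for k l
    proof -
      have "x k \<in> F l"
        using that by (simp add: F_def)
      moreover have "x k \<in> P l \<longleftrightarrow> ((k, 0), (l, 1)) \<in> D"
        using that x(1) by (auto simp: P_def inj_def)
      ultimately show ?thesis
        using y(2)[of l] \<open>graph UNIV E\<close> by (auto simp: U_def graph_def)
    qed
    have "half_E u v"
      using D uv unfolding orientation_def by blast
    then consider k l where "k \<le> l" "u = (k, 0)" "v = (l, 1)"
      | k l where "k \<le> l" "v = (k, 0)" "u = (l, 1)"
      by (cases u; cases v) (auto simp: half_E_def)
    then show ?thesis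
    proof cases
      case 1
      then show ?thesis
        using edge uv by (auto simp: f_def upward_orientation_def)
    next
      case 2
      then have "((k, 0), (l, 1)) \<notin> D"
        using D uv \<open>half_E u v\<close> unfolding orientation_def by blast
      moreover have "\<not> y l <\<^sub>W x k"
        using edge[OF 2(1)] trans irrefl by blast
      ultimately show ?thesis
        using edge[OF 2(1)] 2 by (auto simp: f_def upward_orientation_def)
    qed
  qed
  ultimately show ?thesis
    unfolding embeds_into_def by blast
qed

lemma ex_orientation:
  assumes "diamond_plus W" and E: "graph UNIV E"
  shows "\<exists>D. orientation E D \<and>
    (\<forall>A. \<not> (\<exists>col :: 'w \<Rightarrow> nat. proper_colouring E A col UNIV) \<longrightarrow>
      (\<forall>D'. orientation half_E D' \<longrightarrow> embeds_into half_V D' D A))"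
proof -
  obtain S :: "'w \<Rightarrow> 'w set set" where cntS: "\<And>b. countable (S b)"
    and guess: "\<And>X. \<exists>C. club W C \<and> (\<forall>b\<in>C. X \<inter> {a. a <\<^sub>W b} \<in> S b)"
    using \<open>diamond_plus W\<close> unfolding diamond_plus_def underS_eq by metis
  obtain c :: "'w \<Rightarrow> 'w set \<times> 'w set"
    where c: "\<And>F P. finite F \<Longrightarrow> finite P \<Longrightarrow> (F, P) \<in> range c" and fin_c: "\<And>\<xi>. finite (fst (c \<xi>))"
    by (rule ex_pattern_code) blast
  define N where "N y = {x. x <\<^sub>W y \<and> E x y}" for y
  define met where
    "met T y \<xi> \<longleftrightarrow> fst (c \<xi>) \<subseteq> N y \<and> T \<inter> fst (c \<xi>) = snd (c \<xi>) \<inter> fst (c \<xi>)" for T y \<xi>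
  have "\<exists>T. \<forall>d B. \<not> y <\<^sub>W d \<longrightarrow> B \<in> S d \<longrightarrow>
      (\<forall>Z. finite Z \<longrightarrow> (\<exists>\<xi>\<in>B. fst (c \<xi>) \<subseteq> N y - Z)) \<longrightarrow> (\<exists>\<xi>\<in>B. met T y \<xi>)" for y
  proof -
    \<comment> \<open>Only countably many levels \<open>d\<close> are at most \<open>y\<close>, each
      with countably many guesses, so one set \<open>T\<close> can serve them all.\<close>
    have "{d. \<not> y <\<^sub>W d} = insert y {d. d <\<^sub>W y}"
      using linear trans irrefl by blast
    then have "countable (\<Union>d\<in>{d. \<not> y <\<^sub>W d}. S d)"
      using cntS countable_less[of y] by auto
    from ex_set_meeting_requirements[of _ c "N y", OF this fin_c]
    obtain T where T: "\<forall>B\<in>(\<Union>d\<in>{d. \<not> y <\<^sub>W d}. S d).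
        (\<forall>Z. finite Z \<longrightarrow> (\<exists>\<xi>\<in>B. fst (c \<xi>) \<subseteq> N y - Z)) \<longrightarrow> (\<exists>\<xi>\<in>B. met T y \<xi>)"
      unfolding met_def ..
    show ?thesis
    proof (intro exI[of _ T] allI impI)
      fix d B
      assume "\<not> y <\<^sub>W d" "B \<in> S d"
        and large: "\<forall>Z. finite Z \<longrightarrow> (\<exists>\<xi>\<in>B. fst (c \<xi>) \<subseteq> N y - Z)"
      then have "B \<in> (\<Union>d\<in>{d. \<not> y <\<^sub>W d}. S d)"
        by blast
      then show "\<exists>\<xi>\<in>B. met T y \<xi>"
        using T large by metis
    qed
  qed
  then obtain T where T: "\<forall>y d B. \<not> y <\<^sub>W d \<longrightarrow> B \<in> S d \<longrightarrow>
      (\<forall>Z. finite Z \<longrightarrow> (\<exists>\<xi>\<in>B. fst (c \<xi>) \<subseteq> N y - Z)) \<longrightarrow> (\<exists>\<xi>\<in>B. met (T y) y \<xi>)"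
    by metis
  have "embeds_into half_V D (upward_orientation E T) A"
    if uncol: "\<not> (\<exists>col :: 'w \<Rightarrow> nat. proper_colouring E A col UNIV)" and D: "orientation half_E D" for A D
  proof -
    define Bad where "Bad = {\<xi>. countable {y \<in> A. met (T y) y \<xi>}}"
    obtain C where C: "club W C" and CS: "\<And>d. d \<in> C \<Longrightarrow> Bad \<inter> {a. a <\<^sub>W d} \<in> S d"
      using guess by metis
    define code where "code FP = (SOME \<xi>. c \<xi> = FP)" for FP
    have code: "c (code (F, P)) = (F, P)" if "finite F" "finite P" for F P
      using c[OF that] unfolding code_def by (metis (mono_tags, lifting) rangeE someI_ex)
    define seg where "seg a = insert a {x. x <\<^sub>W a}" for a
    have cnt_seg: "countable (seg a)" for a
      using countable_less by (simp add: seg_def)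
    \<comment> \<open>Closure of \<open>d\<close> under \<open>K\<close> has two effects: patterns
      on nonempty finite sets below \<open>d\<close> have codes below \<open>d\<close>, and vertices
      of \<open>A\<close> meeting a bad requirement with index below \<open>d\<close> lie below
      \<open>d\<close>.\<close>
    define K where "K a = code ` (Fpow (seg a) \<times> Fpow (seg a)) \<union>
        (\<Union>\<xi>\<in>seg a \<inter> Bad. {y \<in> A. met (T y) y \<xi>})" for a
    have "countable (K a)" for a
      using cnt_seg[of a] unfolding K_def by (auto intro!: countable_Fpow simp: Bad_def)
    then have club: "club W {d \<in> C. \<forall>a. a <\<^sub>W d \<longrightarrow> (\<forall>k\<in>K a. k <\<^sub>W d)}"
      by (rule club_closure_points[OF C])
    \<comment> \<open>Otherwise the club of closure points would yield a countable colouring of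
      \<open>A\<close>.\<close>
    obtain d y where d: "d \<in> C" and dK: "\<And>a k. a <\<^sub>W d \<Longrightarrow> k \<in> K a \<Longrightarrow> k <\<^sub>W d"
      and y: "y \<in> A" "\<not> y <\<^sub>W d" and inf: "infinite {x \<in> A. x <\<^sub>W d \<and> E x y}"
      using countable_colouring_if_finite_below_club[OF club E, of A] uncol by blast
    have "\<not> met (T y) y \<xi>" if "\<xi> \<in> Bad" "\<xi> <\<^sub>W d" for \<xi>
      using dK[OF that(2), of y] that(1) y by (auto simp: K_def seg_def)
    then have "\<not> (\<exists>\<xi>\<in>Bad \<inter> {a. a <\<^sub>W d}. met (T y) y \<xi>)"
      by blast
    \<comment> \<open>Contrapositive of the property of \<open>T y\<close> for the guess of
      \<open>Bad\<close> at level \<open>d\<close>: none of its requirements is met at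
      \<open>y\<close>, so some finite \<open>Z\<close> hits every one whose first component lies in
      \<open>N y\<close>.\<close>
    then obtain Z where Z: "finite Z"
      and avoid: "\<And>\<xi>. \<xi> \<in> Bad \<Longrightarrow> \<xi> <\<^sub>W d \<Longrightarrow> \<not> fst (c \<xi>) \<subseteq> N y - Z"
      using T[rule_format, OF y(2) CS[OF d]] by blast
    define X where "X = {x \<in> A. x <\<^sub>W d \<and> E x y} - Z"
    show ?thesis
    proof (rule half_graph_embeds[OF E _ _ D])
      show "infinite X"
        using inf Z by (simp add: X_def Diff_infinite_finite)
      show "X \<subseteq> A"
        by (auto simp: X_def)
    next
      fix F P assume F: "finite F" "F \<noteq> {}" "F \<subseteq> X" and "P \<subseteq> F"
      then have finP: "finite P"
        using finite_subset by blast
      \<comment> \<open>The largest element of the nonempty finite set \<open>F\<close> serves as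
        \<open>a\<close>, which brings the code of \<open>(F, P)\<close> into
        \<open>K a\<close>.\<close>
      obtain a where a: "a <\<^sub>W d" "F \<subseteq> seg a"
        using finite_bounded_below[of F d] F unfolding X_def seg_def by blast
      then have "code (F, P) \<in> K a"
        using F(1) finP \<open>P \<subseteq> F\<close> by (auto simp: K_def Fpow_def)
      then have "code (F, P) <\<^sub>W d"
        using dK a by blast
      moreover have "F \<subseteq> N y - Z"
        using F(3) y(2) linear trans unfolding X_def N_def by blast
      ultimately have "code (F, P) \<notin> Bad"
        using avoid[of "code (F, P)"] code[OF F(1) finP] by auto
      then show "\<not> countable {y \<in> A. F \<subseteq> {x. x <\<^sub>W y \<and> E x y} \<and> T y \<inter> F = P}"
        using \<open>P \<subseteq> F\<close> by (simp add: Bad_def met_def code[OF F(1) finP] N_def Int_absorb2)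
    qed
  qed
  then show ?thesis
    using orientation_upward[OF E] by blast
qed

end

section \<open>Uncountable chromatic number and transfer to the given graph\<close>

text \<open>Colours in the natural numbers could be moved injectively into a countable subset of
  \<open>'w\<close>, whose cardinality is below omega_1.\<close>

lemma chromatic_eq_not_countably_colourable:
  assumes "is_omega1 (W :: 'w rel)" and "chromatic_eq E A (UNIV :: 'w set)"
  shows "\<not> (\<exists>col :: 'a \<Rightarrow> nat. proper_colouring E A col UNIV)"
proof
  assume "\<exists>col :: 'a \<Rightarrow> nat. proper_colouring E A col UNIV"
  then obtain col :: "'a \<Rightarrow> nat" where col: "proper_colouring E A col UNIV"
    by blast
  have unc: "\<not> countable (UNIV :: 'w set)"
    using assms(1) by (simp add: is_omega1_def)
  then have "infinite (UNIV :: 'w set)"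
    using countable_finite by blast
  then obtain i :: "nat \<Rightarrow> 'w" where i: "inj i"
    by (meson infinite_countable_subset)
  have "\<not> (card_of (UNIV :: 'w set), card_of (range i)) \<in> ordLeq"
  proof
    assume "(card_of (UNIV :: 'w set), card_of (range i)) \<in> ordLeq"
    then obtain j :: "'w \<Rightarrow> 'w" where "inj j" "range j \<subseteq> range i"
      unfolding card_of_ordLeq[symmetric] by blast
    moreover have "countable (range i)"
      by simp
    ultimately show False
      using unc countable_subset countable_image_inj_on by blast
  qed
  then have "(card_of (range i), card_of (UNIV :: 'w set)) \<in> ordLess"
    by simp
  moreover have "proper_colouring E A (i \<circ> col) (range i)"
    using col i by (auto simp: proper_colouring_def inj_def)
  ultimately show False
    using assms(2) unfolding chromatic_eq_def by blast
qed

theorem theorem4p8: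
  fixes W :: "'w rel" and V :: "'a set" and E :: "'a \<Rightarrow> 'a \<Rightarrow> bool"
  assumes "is_omega1 W"
    and "diamond_plus W"
    and "graph V E"
    and "(card_of V, card_of (UNIV :: 'w set)) \<in> ordIso"
    and "chromatic_eq E V (UNIV :: 'w set)"
  shows "\<exists>Dstar. orientation E Dstar \<and>
           (\<forall>A. A \<subseteq> V \<and> chromatic_eq E A (UNIV :: 'w set) \<longrightarrow>
              (\<forall>D. orientation half_E D \<longrightarrow> embeds_into half_V D Dstar A))"
proof -
  interpret omega1 W
    by unfold_locales (rule assms(1))
  obtain h where h: "bij_betw h V (UNIV :: 'w set)"
    using assms(4) unfolding card_of_ordIso[symmetric] by blast
  define g where "g = inv_into V h"
  have g: "bij_betw g UNIV V"
    unfolding g_def by (rule bij_betw_inv_into[OF h])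
  have hg: "h (g a) = a" for a
    using h by (simp add: g_def bij_betw_inv_into_right)
  have gh: "g (h u) = u" if "u \<in> V" for u
    using h that by (simp add: g_def bij_betw_inv_into_left)
  have gV: "g a \<in> V" for a
    using g by (auto simp: bij_betw_def)
  have EV: "u \<in> V \<and> v \<in> V" if "E u v" for u v
    using assms(3) that by (auto simp: graph_def)
  \<comment> \<open>The graph is copied to omega_1 along the bijection \<open>h\<close> with inverse
    \<open>g\<close>.\<close>
  define E' where "E' a b = E (g a) (g b)" for a b
  have "graph UNIV E'"
    using assms(3) by (auto simp: graph_def E'_def)
  then obtain D' where D': "orientation E' D'"
    and emb: "\<And>A D. \<not> (\<exists>col :: 'w \<Rightarrow> nat. proper_colouring E' A col UNIV) \<Longrightarrow>
        orientation half_E D \<Longrightarrow> embeds_into half_V D D' A"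
    using ex_orientation[OF assms(2)] by blast
  \<comment> \<open>The orientation is pulled back along \<open>h\<close> and confined to
    \<open>V\<close>, since the values of \<open>h\<close> outside \<open>V\<close> are
    arbitrary.\<close>
  define Dstar where "Dstar = {(u, v). u \<in> V \<and> v \<in> V \<and> (h u, h v) \<in> D'}"
  have "orientation E Dstar"
    unfolding orientation_def
  proof (intro conjI allI impI)
    fix u v
    show "E u v" if "(u, v) \<in> Dstar"
      using D' that gh unfolding orientation_def Dstar_def E'_def by (metis (lifting) case_prodD mem_Collect_eq)
    show "(u, v) \<in> Dstar \<longleftrightarrow> (v, u) \<notin> Dstar" if "E u v"
    proof -
      have "E' (h u) (h v)"
        using EV[OF that] gh that by (simp add: E'_def)
      then show ?thesis
        using D' EV[OF that] by (simp add: orientation_def Dstar_def)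
    qed
  qed
  moreover have "embeds_into half_V D Dstar A"
    if A: "A \<subseteq> V" "chromatic_eq E A (UNIV :: 'w set)" and D: "orientation half_E D" for A D
  proof -
    have "\<not> (\<exists>col :: 'w \<Rightarrow> nat. proper_colouring E' (h ` A) col UNIV)"
    proof
      assume "\<exists>col :: 'w \<Rightarrow> nat. proper_colouring E' (h ` A) col UNIV"
      then obtain col :: "'w \<Rightarrow> nat" where "proper_colouring E' (h ` A) col UNIV" ..
      then have "proper_colouring E A (col \<circ> h) UNIV"
        using A(1) gh by (auto simp: proper_colouring_def E'_def subset_iff)
      then show False
        using chromatic_eq_not_countably_colourable[OF assms(1) A(2)] by blast
    qed
    from emb[OF this D] obtain f where f: "inj_on f half_V" "f ` half_V \<subseteq> h ` A"
      "\<forall>(x, y)\<in>D. (f x, f y) \<in> D'"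
      unfolding embeds_into_def by (elim exE conjE)
    have "inj g"
      using g by (simp add: bij_betw_def)
    then have "inj_on (g \<circ> f) half_V"
      using f(1) by (meson comp_inj_on inj_on_subset subset_UNIV)
    moreover have "(g \<circ> f) ` half_V \<subseteq> A"
      using f(2) A(1) gh by fastforce
    moreover have "(g (f x), g (f y)) \<in> Dstar" if "(x, y) \<in> D" for x y
      using f(3) that gV hg by (auto simp: Dstar_def)
    ultimately show ?thesis
      unfolding embeds_into_def by (intro exI[of _ "g \<circ> f"]) auto
  qed
  ultimately show ?thesis
    by blast
qed

end
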